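(* Let $X$ be a complete $\mathrm{CAT}(0)$ space with no fake zero angles. Let $g_1,g_2$ be axial isometries of $X$ with axes $A_1,A_2$ respectively. Assume that either one of the following holds: (1) $S=A_1\cap A_2$ is a bounded segment. Let $s_-,s_+$ be its endpoints, and for $i=1,2$ let $A_i^{-},A_i^{+}$ be the infinite rays of $A_i$ with origins $s_-,s_+$ respectively (so that $A_i=A_i^-\cup S\cup A_i^+$). Assume that the angle between $A_1^+$ and $A_2^+$ (at $s_+$) and the angle between $A_1^-$ and $A_2^-$ (at $s_-$) are equal to $\pi$, and that the translation lengths of $g_1$ and $g_2$ are strictly greater than the length of $S$. (2) $A_1$ and $A_2$ are disjoint, and there is a geodesic $B$ connecting a point $a_1\in A_1$ to a point $a_2\in A_2$ such that all four angles between $B$ and $A_1,A_2$ at $a_1,a_2$ (that is, for $i=1,2$, the angles at $a_i$ between $B$ and each of the two rays of $A_i$ issuing from $a_i$) are equal to $\pi$. Then the group generated by $g_1,g_2$ is free.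
   Context: A geodesic metric space is $\mathrm{CAT}(0)$ (nonpositively curved) if, for every geodesic triangle $\Delta$ and any two points $x,y$ on $\Delta$, $d(x,y)$ is at most the Euclidean distance between the corresponding points of the comparison triangle in the Euclidean plane with the same side lengths. Angles: if $\sigma_1,\sigma_2:[0,\varepsilon]\to X$ are unit speed geodesics with $\sigma_1(0)=\sigma_2(0)=x$, then $\angle(\sigma_1,\sigma_2)=\lim_{s,t\to 0}\gamma(s,t)$, where $\gamma(s,t)$ is the angle at the vertex corresponding to $x$ in the Euclidean comparison triangle of $x,\sigma_1(s),\sigma_2(t)$ (the limit exists in a $\mathrm{CAT}(0)$ space). A complete $\mathrm{CAT}(0)$ space $X$ has no fake zero angles if there is no pair of (nontrivial) geodesics which issue from the same point, subtend zero angle at that point, and are disjoint except at that point. An isometry $g$ of $X$ is axial if there is a geodesic line $A\subset X$ (an axis of $g$) that is invariant under $g$ and on which $g$ acts as a nontrivial translation; the amount of this translation is the translation length of $g$.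
   Formalization: If S is a single point, the labelling of the rays A_i^-, A_i^+ is ambiguous; the angle condition is then required for every labelling (all four angles between A_1 and A_2 equal π), since with one labelling only the group need not be free. *)

theory Defs
  imports "HOL-Analysis.Analysis" "HOL-Algebra.Elementary_Groups"
begin

section \<open>Geodesics\<close>

text \<open>All geodesics are parametrised by arc length; only the values on \<^term>\<open>I\<close> matter.\<close>

definition geodesic_on :: "real set \<Rightarrow> (real \<Rightarrow> 'a::metric_space) \<Rightarrow> bool" where
  "geodesic_on I c \<longleftrightarrow> (\<forall>s\<in>I. \<forall>t\<in>I. dist (c s) (c t) = \<bar>s - t\<bar>)"

definition geodesic_joining :: "(real \<Rightarrow> 'a::metric_space) \<Rightarrow> 'a \<Rightarrow> 'a \<Rightarrow> bool" where
  "geodesic_joining c x y \<longleftrightarrow>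
     geodesic_on {0..dist x y} c \<and> c 0 = x \<and> c (dist x y) = y"

definition geodesic_segment :: "'a::metric_space set \<Rightarrow> 'a \<Rightarrow> 'a \<Rightarrow> bool" where
  "geodesic_segment S x y \<longleftrightarrow> (\<exists>c. geodesic_joining c x y \<and> S = c ` {0..dist x y})"

definition geodesic_ray_from :: "'a::metric_space \<Rightarrow> (real \<Rightarrow> 'a) \<Rightarrow> bool" where
  "geodesic_ray_from x r \<longleftrightarrow> geodesic_on {0..} r \<and> r 0 = x"

section \<open>Comparison triangles and CAT(0) spaces\<close>

definition comparison_triangle ::
    "'a::metric_space \<Rightarrow> 'a \<Rightarrow> 'a \<Rightarrow> real^2 \<Rightarrow> real^2 \<Rightarrow> real^2 \<Rightarrow> bool" where
  "comparison_triangle p q r p' q' r' \<longleftrightarrow>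
     dist p' q' = dist p q \<and> dist q' r' = dist q r \<and> dist r' p' = dist r p"

text \<open>\<^term>\<open>x'\<close> is the point of the Euclidean side from \<^term>\<open>p'\<close> to \<^term>\<open>q'\<close> that
  corresponds to the point \<^term>\<open>x\<close> of the side \<^term>\<open>S\<close> from \<^term>\<open>p\<close> to \<^term>\<open>q\<close>.\<close>

definition corresponds_on_side ::
    "'a::metric_space set \<Rightarrow> 'a \<Rightarrow> real^2 \<Rightarrow> real^2 \<Rightarrow> 'a \<Rightarrow> real^2 \<Rightarrow> bool" where
  "corresponds_on_side S p p' q' x x' \<longleftrightarrow>
     x \<in> S \<and> x' \<in> closed_segment p' q' \<and> dist p' x' = dist p x"

definition geodesic_space :: "'a::metric_space itself \<Rightarrow> bool" where
  "geodesic_space _ \<longleftrightarrow> (\<forall>x y::'a. \<exists>c. geodesic_joining c x y)"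

definition CAT0 :: "'a::metric_space itself \<Rightarrow> bool" where
  "CAT0 T \<longleftrightarrow> geodesic_space T \<and>
     (\<forall>(p::'a) q r Spq Sqr Srp p' q' r' x y x' y'.
        geodesic_segment Spq p q \<and> geodesic_segment Sqr q r \<and> geodesic_segment Srp r p \<and>
        comparison_triangle p q r p' q' r' \<and>
        (corresponds_on_side Spq p p' q' x x' \<or> corresponds_on_side Sqr q q' r' x x' \<or>
         corresponds_on_side Srp r r' p' x x') \<and>
        (corresponds_on_side Spq p p' q' y y' \<or> corresponds_on_side Sqr q q' r' y y' \<or>
         corresponds_on_side Srp r r' p' y y')
        \<longrightarrow> dist x y \<le> dist x' y')"

section \<open>Angles\<close>

definition euclidean_angle :: "real^2 \<Rightarrow> real^2 \<Rightarrow> real^2 \<Rightarrow> real" where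
  "euclidean_angle p q r = arccos (((q - p) \<bullet> (r - p)) / (norm (q - p) * norm (r - p)))"

text \<open>The angle at the vertex corresponding to \<^term>\<open>p\<close>; a comparison triangle exists and is unique
  up to congruence, so the description is proper.\<close>

definition comparison_angle :: "'a::metric_space \<Rightarrow> 'a \<Rightarrow> 'a \<Rightarrow> real" where
  "comparison_angle p q r =
     (THE \<theta>. \<exists>p' q' r'. comparison_triangle p q r p' q' r' \<and> \<theta> = euclidean_angle p' q' r')"

text \<open>\<open>has_angle c1 c2 \<theta>\<close>: the angle between \<^term>\<open>c1\<close> and \<^term>\<open>c2\<close> at their common
  origin exists and equals \<^term>\<open>\<theta>\<close>.\<close>

definition has_angle :: "(real \<Rightarrow> 'a::metric_space) \<Rightarrow> (real \<Rightarrow> 'a) \<Rightarrow> real \<Rightarrow> bool" where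
  "has_angle c1 c2 \<theta> \<longleftrightarrow>
     ((\<lambda>(s, t). comparison_angle (c1 0) (c1 s) (c2 t)) \<longlongrightarrow> \<theta>) (at_right 0 \<times>\<^sub>F at_right 0)"

definition no_fake_zero_angles :: "'a::metric_space itself \<Rightarrow> bool" where
  "no_fake_zero_angles _ \<longleftrightarrow>
     \<not> (\<exists>(c1 :: real \<Rightarrow> 'a) c2 a b. a > 0 \<and> b > 0 \<and>
          geodesic_on {0..a} c1 \<and> geodesic_on {0..b} c2 \<and> c1 0 = c2 0 \<and>
          has_angle c1 c2 0 \<and> c1 ` {0..a} \<inter> c2 ` {0..b} = {c1 0})"

section \<open>Isometries and axes\<close>

definition isometry :: "('a::metric_space \<Rightarrow> 'a) \<Rightarrow> bool" where
  "isometry g \<longleftrightarrow> surj g \<and> (\<forall>x y. dist (g x) (g y) = dist x y)"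

definition isometry_group :: "('a::metric_space \<Rightarrow> 'a) monoid" where
  "isometry_group = \<lparr>carrier = {g. isometry g}, mult = (\<circ>), one = id\<rparr>"

text \<open>\<^term>\<open>g\<close> moves every point of the geodesic line \<^term>\<open>A\<close> along \<^term>\<open>A\<close> by the
  amount \<^term>\<open>l\<close>, all in the same direction.\<close>

definition translates_line :: "('a::metric_space \<Rightarrow> 'a) \<Rightarrow> 'a set \<Rightarrow> real \<Rightarrow> bool" where
  "translates_line g A l \<longleftrightarrow>
     (\<exists>c \<tau>. geodesic_on UNIV c \<and> A = range c \<and> (\<forall>t. g (c t) = c (t + \<tau>)) \<and> l = \<bar>\<tau>\<bar>)"

definition is_axis :: "('a::metric_space \<Rightarrow> 'a) \<Rightarrow> 'a set \<Rightarrow> bool" where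
  "is_axis g A \<longleftrightarrow> isometry g \<and> (\<exists>l>0. translates_line g A l)"

definition translation_length :: "('a::metric_space \<Rightarrow> 'a) \<Rightarrow> 'a set \<Rightarrow> real" where
  "translation_length g A = (THE l. translates_line g A l)"

lemma geodesic_on_UNIV_dist: "geodesic_on UNIV c \<Longrightarrow> dist (c s) (c t) = \<bar>s - t\<bar>"
  by (simp add: geodesic_on_def)

lemma translation_length_eq:
  assumes "translates_line g A l"
  shows "translation_length g A = l"
proof -
  have "dist x (g x) = l'" if "translates_line g A l'" "x \<in> A" for l' x
    using that unfolding translates_line_def by (auto simp: geodesic_on_UNIV_dist)
  moreover obtain x where "x \<in> A"
    using assms unfolding translates_line_def by auto
  ultimately show ?thesis
    using assms unfolding translation_length_def by (metis the_equality)
qed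

lemma group_isometry_group: "group (isometry_group :: ('a::metric_space \<Rightarrow> 'a) monoid)"
proof (rule groupI)
  fix g :: "'a \<Rightarrow> 'a" assume "g \<in> carrier isometry_group"
  then have g: "surj g" "\<And>x y. dist (g x) (g y) = dist x y"
    by (auto simp: isometry_group_def isometry_def)
  have inj: "inj g" using g(2) by (metis dist_eq_0_iff injI)
  have "isometry (inv_into UNIV g)"
    unfolding isometry_def using g inj by (metis inj_imp_surj_inv surj_f_inv_f)
  moreover have "inv_into UNIV g \<circ> g = id" using inj by simp
  ultimately show "\<exists>h\<in>carrier isometry_group. h \<otimes>\<^bsub>isometry_group\<^esub> g = \<one>\<^bsub>isometry_group\<^esub>"
    by (auto simp: isometry_group_def)
qed (simp_all add: isometry_group_def isometry_def comp_surj[unfolded comp_def] comp_def)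

section \<open>The two configurations of axes\<close>

text \<open>\<^term>\<open>rm\<close> and \<^term>\<open>rp\<close> parametrise the two infinite rays that remain of the line
  \<^term>\<open>A\<close> outside the segment \<^term>\<open>S\<close> with endpoints \<^term>\<open>sm\<close> and \<^term>\<open>sp\<close>.
  For \<^prop>\<open>sm \<noteq> sp\<close> they are determined (on \<^term>\<open>{0::real..}\<close>) by the other data.  If
  \<^term>\<open>S\<close> is a single point, either ray of \<^term>\<open>A\<close> may play either role.\<close>

definition complementary_rays ::
    "'a::metric_space set \<Rightarrow> 'a set \<Rightarrow> 'a \<Rightarrow> 'a \<Rightarrow> (real \<Rightarrow> 'a) \<Rightarrow> (real \<Rightarrow> 'a) \<Rightarrow> bool" where
  "complementary_rays A S sm sp rm rp \<longleftrightarrow>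
     geodesic_ray_from sm rm \<and> geodesic_ray_from sp rp \<and>
     rm ` {0..} \<inter> S = {sm} \<and> rp ` {0..} \<inter> S = {sp} \<and>
     A = rm ` {0..} \<union> S \<union> rp ` {0..}"

text \<open>The quantification over all complementary rays only matters when the segment is a single
  point: there the labelling of the rays is ambiguous, and the angle condition is imposed for every
  labelling.  Imposing it for one labelling only would not give freeness: in the Cayley complex of
  \<open>\<langle>a, b | (ab)\<^sup>2\<rangle>\<close> (with one unit square for each
  closed edge path labelled by the relator) the axes of \<open>a\<close> and \<open>b\<close>
  through a vertex satisfy the condition for one labelling.\<close>

definition axes_meet_in_segment ::
    "('a::metric_space \<Rightarrow> 'a) \<Rightarrow> 'a set \<Rightarrow> ('a \<Rightarrow> 'a) \<Rightarrow> 'a set \<Rightarrow> bool" where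
  "axes_meet_in_segment g1 A1 g2 A2 \<longleftrightarrow>
     (\<exists>sm sp. geodesic_segment (A1 \<inter> A2) sm sp \<and>
        (\<forall>r1m r1p r2m r2p.
           complementary_rays A1 (A1 \<inter> A2) sm sp r1m r1p \<and>
           complementary_rays A2 (A1 \<inter> A2) sm sp r2m r2p \<longrightarrow>
           has_angle r1p r2p pi \<and> has_angle r1m r2m pi) \<and>
        dist sm sp < translation_length g1 A1 \<and>
        dist sm sp < translation_length g2 A2)"

definition axes_joined_by_bridge :: "'a::metric_space set \<Rightarrow> 'a set \<Rightarrow> bool" where
  "axes_joined_by_bridge A1 A2 \<longleftrightarrow>
     A1 \<inter> A2 = {} \<and>
     (\<exists>a1\<in>A1. \<exists>a2\<in>A2. \<exists>b. geodesic_joining b a1 a2 \<and>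
        (\<forall>r. geodesic_ray_from a1 r \<and> r ` {0..} \<subseteq> A1 \<longrightarrow> has_angle b r pi) \<and>
        (\<forall>r. geodesic_ray_from a2 r \<and> r ` {0..} \<subseteq> A2 \<longrightarrow>
             has_angle (\<lambda>t. b (dist a1 a2 - t)) r pi))"

section \<open>Free groups\<close>

text \<open>Words in letters \<open>x\<close> and \<open>x\<^sup>-\<^sup>1\<close>, encoded as
  \<^term>\<open>(True, x)\<close> and \<^term>\<open>(False, x)\<close>.\<close>

definition reduced_word :: "(bool \<times> 'g) list \<Rightarrow> bool" where
  "reduced_word w \<longleftrightarrow> successively (\<lambda>(e, x) (f, y). \<not> (x = y \<and> e \<noteq> f)) w"

definition word_value :: "('g, 'm) monoid_scheme \<Rightarrow> (bool \<times> 'g) list \<Rightarrow> 'g" where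
  "word_value G w =
     foldr (\<lambda>(e, x) y. (if e then x else inv\<^bsub>G\<^esub> x) \<otimes>\<^bsub>G\<^esub> y) w \<one>\<^bsub>G\<^esub>"

definition free_basis :: "('g, 'm) monoid_scheme \<Rightarrow> 'g set \<Rightarrow> bool" where
  "free_basis G B \<longleftrightarrow> B \<subseteq> carrier G \<and>
     bij_betw (word_value G) {w. reduced_word w \<and> snd ` set w \<subseteq> B} (carrier G)"

definition free_group :: "('g, 'm) monoid_scheme \<Rightarrow> bool" where
  "free_group G \<longleftrightarrow> group G \<and> (\<exists>B. free_basis G B)"

end

theory Submission
  imports Defs
begin

text \<open>
  The two axes, together with the bridge in the second configuration, form an isometrically embedded
  tree, and a reduced word in the two translations moves this tree along a geodesic.

  Two facts about a CAT(0) space produce geodesics. If two geodesics issue from a point at angle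
  \<open>\<pi>\<close>, their union is a geodesic: comparison angles increase with the sides, so they
  are all \<open>\<pi>\<close> (\<open>angle_pi_imp_straight\<close>). If two geodesics overlap in a nondegenerate
  segment, their union is again a geodesic (\<open>between_pts_overlap\<close>). By the first fact the
  hypotheses on the angles make distances add up at the branch points; by the second they add up
  between any two points of the tree.

  Each of the four letters \<open>l = g\<^sub>1, g\<^sub>1\<^sup>-\<^sup>1, g\<^sub>2, g\<^sub>2\<^sup>-\<^sup>1\<close> owns a spoke of the tree: with core
  \<open>S\<close> in the first configuration and \<open>B\<close> in the second, it is the part
  \<open>[u\<^sub>l, v\<^sub>l]\<close> of the axis that lies between the core and its translate by \<open>l\<close>. Its
  outer end is \<open>v\<^sub>l = l u\<^bsub>l\<inverse>\<^esub>\<close>. In the first configuration the spoke is nondegenerate because the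
  translation lengths exceed the length of \<open>S\<close>. The union of two distinct spokes with the piece of
  the core between them is a geodesic. Translating such geodesics by the prefixes of a reduced word
  \<open>l\<^sub>1 \<dots> l\<^sub>n\<close> gives a chain in which each overlaps the next in a translated spoke, so that
  the whole path from \<open>u\<close> of \<open>l\<^sub>1\<close> along the spoke of \<open>l\<^sub>1\<close> to the point
  \<open>l\<^sub>1 \<dots> l\<^sub>n u\<close>, where \<open>u\<close> belongs to the inverse of \<open>l\<^sub>n\<close>, is a geodesic
  (\<open>reduced_words_move_spokes\<close>). The point \<open>u\<close> itself, and every other point of the core, is
  not beyond this spoke, so the word does not act as the identity. Hence
  \<open>g\<^sub>1\<close> and \<open>g\<^sub>2\<close> form a free basis.
\<close>

section \<open>Comparison in CAT(0) spaces without the Euclidean plane\<close>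

text \<open>By the law of cosines, this is the cosine of the angle opposite to the side \<^term>\<open>d\<close> in the
  Euclidean triangle with sides \<^term>\<open>a\<close>, \<^term>\<open>b\<close>, \<^term>\<open>d\<close>.\<close>

definition cosine_ratio :: "real \<Rightarrow> real \<Rightarrow> real \<Rightarrow> real" where
  "cosine_ratio a b d = (a\<^sup>2 + b\<^sup>2 - d\<^sup>2) / (2 * a * b)"

lemma dist_sq_inner:
  fixes p q r :: "'b::real_inner"
  shows "(dist q r)\<^sup>2 = (dist p q)\<^sup>2 + (dist p r)\<^sup>2 - 2 * ((q - p) \<bullet> (r - p))"
  by (simp add: dist_norm power2_norm_eq_inner inner_diff_left inner_diff_right inner_commute)

lemma euclidean_angle_eq:
  assumes "p \<noteq> q" "p \<noteq> r"
  shows "euclidean_angle p q r = arccos (cosine_ratio (dist p q) (dist p r) (dist q r))"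
proof -
  have "(dist p q)\<^sup>2 + (dist p r)\<^sup>2 - (dist q r)\<^sup>2 = 2 * ((q - p) \<bullet> (r - p))"
    using dist_sq_inner[of q r p] by simp
  then have "cosine_ratio (dist p q) (dist p r) (dist q r) = (q - p) \<bullet> (r - p) / (dist p q * dist p r)"
    by (simp add: cosine_ratio_def)
  moreover have "norm (q - p) = dist p q" "norm (r - p) = dist p r"
    by (simp_all add: dist_norm norm_minus_commute)
  ultimately show ?thesis
    by (simp add: euclidean_angle_def)
qed

lemma comparison_triangle_exists:
  fixes p q r :: "'a::metric_space"
  assumes "p \<noteq> q"
  shows "\<exists>p' q' r'. comparison_triangle p q r p' q' r'"
proof -
  define a b d where "a = dist p q" and "b = dist p r" and "d = dist q r"
  \<comment> \<open>The first coordinate of the third vertex when the first two lie at \<^term>\<open>0::real\<close> and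
    \<^term>\<open>a\<close> on the horizontal axis. The triangle inequalities say that it is at most
    \<^term>\<open>b\<close> in absolute value, which leaves room for the second coordinate.\<close>
  define x where "x = (a\<^sup>2 + b\<^sup>2 - d\<^sup>2) / (2 * a)"
  have a: "a > 0" and bd: "b \<ge> 0" "d \<ge> 0"
    using assms by (auto simp: a_def b_def d_def)
  have tri: "d \<le> a + b" "a \<le> b + d" "b \<le> a + d"
    unfolding a_def b_def d_def by metric+
  have ax: "2 * a * x = a\<^sup>2 + b\<^sup>2 - d\<^sup>2"
    using a by (simp add: x_def)
  have "d\<^sup>2 \<le> (a + b)\<^sup>2"
    using tri bd by (intro power_mono) auto
  then have "2 * a * (- b) \<le> 2 * a * x"
    unfolding ax by (simp add: power2_eq_square algebra_simps)
  moreover have "(a - b)\<^sup>2 \<le> d\<^sup>2"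
    using tri bd by (intro abs_le_square_iff[THEN iffD1]) auto
  then have "2 * a * x \<le> 2 * a * b"
    unfolding ax by (simp add: power2_eq_square algebra_simps)
  ultimately have "- b \<le> x" "x \<le> b"
    using a by (simp_all only: mult_le_cancel_left_pos[of "2 * a"] mult_pos_pos zero_less_numeral)
  then have "\<bar>x\<bar> \<le> b"
    by simp
  then have y: "x\<^sup>2 \<le> b\<^sup>2"
    by (metis abs_le_square_iff abs_of_nonneg bd(1))
  define q' r' :: "real^2" where "q' = vector [a, 0]" and "r' = vector [x, sqrt (b\<^sup>2 - x\<^sup>2)]"
  have "dist 0 q' = a"
    using a by (simp add: q'_def norm_vec_def L2_set_def sum_2)
  moreover have "dist r' 0 = b"
    using bd y by (simp add: r'_def norm_vec_def L2_set_def sum_2)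
  moreover have "dist q' r' = d"
  proof -
    have "(a - x)\<^sup>2 + (b\<^sup>2 - x\<^sup>2) = d\<^sup>2"
      using ax by (simp add: power2_eq_square algebra_simps)
    then show ?thesis
      using bd y by (simp add: q'_def r'_def dist_vec_def L2_set_def sum_2 dist_real_def)
  qed
  ultimately show ?thesis
    unfolding comparison_triangle_def a_def b_def d_def by (metis dist_commute)
qed

lemma comparison_angle_eq:
  assumes "p \<noteq> q" "p \<noteq> r"
  shows "comparison_angle p q r = arccos (cosine_ratio (dist p q) (dist p r) (dist q r))"
proof -
  have *: "euclidean_angle p' q' r' = arccos (cosine_ratio (dist p q) (dist p r) (dist q r))"
    if "comparison_triangle p q r p' q' r'" for p' q' r'
  proof -
    have "dist p' q' = dist p q" "dist p' r' = dist p r" "dist q' r' = dist q r"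
      using that by (simp_all add: comparison_triangle_def dist_commute)
    then show ?thesis
      using assms euclidean_angle_eq[of p' q' r'] by (metis dist_eq_0_iff)
  qed
  show ?thesis
    unfolding comparison_angle_def
    using comparison_triangle_exists[OF assms(1), of r] * by (intro the_equality) metis+
qed

lemma geodesic_segment_sym:
  assumes "geodesic_segment S x y"
  shows "geodesic_segment S y x"
proof -
  obtain c where c: "geodesic_joining c x y" and S: "S = c ` {0..dist x y}"
    using assms by (auto simp: geodesic_segment_def)
  have "geodesic_joining (\<lambda>t. c (dist x y - t)) y x"
    using c by (auto simp: geodesic_joining_def geodesic_on_def dist_commute)
  moreover have "(\<lambda>t. c (dist x y - t)) ` {0..dist y x} = S"
  proof -
    have "(\<lambda>t. dist x y - t) ` {0..dist x y} = {0..dist x y}"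
      by (auto intro: image_eqI[of _ _ "dist x y - t" for t])
    then show ?thesis
      unfolding S dist_commute[of y x] by (metis image_image)
  qed
  ultimately show ?thesis
    unfolding geodesic_segment_def by metis
qed

lemma geodesic_segment_image:
  assumes "geodesic_on {0..a} c" "a \<ge> 0"
  shows "geodesic_segment (c ` {0..a}) (c 0) (c a)"
proof -
  have "dist (c 0) (c a) = a"
    using assms by (auto simp: geodesic_on_def)
  then show ?thesis
    unfolding geodesic_segment_def geodesic_joining_def using assms(1) by metis
qed

text \<open>Comparison angles at a vertex shrink, i.e. their cosines grow, when the two sides are shortened.
  The points of the comparison triangle that correspond to \<^term>\<open>c1 s\<close> and \<^term>\<open>c2 t\<close> see
  each other from the vertex under the angle of the whole comparison triangle, while by CAT(0)
  the distance of \<^term>\<open>c1 s\<close> and \<^term>\<open>c2 t\<close> is at most theirs.\<close>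

lemma CAT0_hinge_comparison:
  fixes c1 c2 :: "real \<Rightarrow> 'a::metric_space"
  assumes "CAT0 TYPE('a)"
    and c1: "geodesic_on {0..a} c1" and c2: "geodesic_on {0..b} c2" and o: "c1 0 = c2 0"
    and s: "0 < s" "s \<le> a" and t: "0 < t" "t \<le> b"
  shows "cosine_ratio a b (dist (c1 a) (c2 b)) \<le> cosine_ratio s t (dist (c1 s) (c2 t))"
proof -
  let ?p = "c1 0" and ?q = "c1 a" and ?r = "c2 b"
  have ab: "a > 0" "b > 0" using s t by auto
  have d: "dist ?p (c1 s) = s" "dist ?p ?q = a" "dist ?p (c2 t) = t" "dist ?p ?r = b"
    "dist ?r (c2 t) = b - t"
    using c1 c2 s t unfolding o geodesic_on_def
    by (auto simp: o[symmetric]) (auto simp: o)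
  obtain p' q' r' where tri: "comparison_triangle ?p ?q ?r p' q' r'"
    using comparison_triangle_exists d(2) ab by (metis dist_self less_irrefl)
  then have d': "dist p' q' = a" "dist p' r' = b" "dist q' r' = dist ?q ?r"
    using d by (simp_all add: comparison_triangle_def dist_commute)
  define x' y' where "x' = p' + (s / a) *\<^sub>R (q' - p')" and "y' = p' + (t / b) *\<^sub>R (r' - p')"
  have x'_dist: "dist p' x' = s" and y'_dist: "dist p' y' = t"
    using s t ab d' by (simp_all add: x'_def y'_def dist_norm norm_minus_commute)
  have x'_seg: "x' \<in> closed_segment p' q'"
    using s ab by (auto simp: x'_def closed_segment_def algebra_simps intro!: exI[of _ "s/a"])
  have y'_seg: "y' \<in> closed_segment r' p'"
    unfolding closed_segment_commute[of r' p']
    using t ab by (auto simp: y'_def closed_segment_def algebra_simps intro!: exI[of _ "t/b"])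
  have "dist r' y' = b - t"
  proof -
    have "r' - y' = (1 - t / b) *\<^sub>R (r' - p')"
      by (simp add: y'_def algebra_simps)
    then have "dist r' y' = \<bar>1 - t / b\<bar> * b"
      using d'(2) by (simp add: dist_norm norm_minus_commute)
    then show ?thesis
      using t ab by (simp add: left_diff_distrib)
  qed
  then have "corresponds_on_side (c2 ` {0..b}) ?r r' p' (c2 t) y'"
    using y'_seg t d by (auto simp: corresponds_on_side_def)
  moreover have "corresponds_on_side (c1 ` {0..a}) ?p p' q' (c1 s) x'"
    using x'_seg s d x'_dist by (auto simp: corresponds_on_side_def)
  moreover have "geodesic_segment (c1 ` {0..a}) ?p ?q"
    using geodesic_segment_image[OF c1] ab by simp
  moreover have "geodesic_segment (c2 ` {0..b}) ?r ?p"
    unfolding o using geodesic_segment_sym[OF geodesic_segment_image[OF c2]] ab by simp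
  moreover obtain S where "geodesic_segment S ?q ?r"
    using assms(1) unfolding CAT0_def geodesic_space_def geodesic_segment_def by blast
  ultimately have "dist (c1 s) (c2 t) \<le> dist x' y'"
    using assms(1) tri unfolding CAT0_def by blast
  then have "(dist (c1 s) (c2 t))\<^sup>2 \<le> (dist x' y')\<^sup>2"
    by (simp add: power_mono)
  also have "\<dots> = s\<^sup>2 + t\<^sup>2 - 2 * ((s / a) * (t / b) * ((q' - p') \<bullet> (r' - p')))"
    unfolding dist_sq_inner[of x' y' p'] x'_dist y'_dist by (simp add: x'_def y'_def mult.commute mult.left_commute)
  also have "\<dots> = s\<^sup>2 + t\<^sup>2 - 2 * s * t * cosine_ratio a b (dist ?q ?r)"
  proof -
    have "a\<^sup>2 + b\<^sup>2 - (dist ?q ?r)\<^sup>2 = 2 * ((q' - p') \<bullet> (r' - p'))"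
      using dist_sq_inner[of q' r' p'] d' by simp
    then have "cosine_ratio a b (dist ?q ?r) = ((q' - p') \<bullet> (r' - p')) / (a * b)"
      by (simp add: cosine_ratio_def)
    then show ?thesis by simp
  qed
  finally show ?thesis
    using s t unfolding cosine_ratio_def[of s t] by (simp add: field_simps)
qed

lemma cosine_ratio_le_minus_one:
  assumes "a > 0" "b > 0" "d \<ge> 0" "cosine_ratio a b d \<le> -1"
  shows "a + b \<le> d"
proof -
  have "(a + b)\<^sup>2 \<le> d\<^sup>2"
    using assms by (simp add: cosine_ratio_def field_simps power2_eq_square)
  then show ?thesis using assms(3) by (rule power2_le_imp_le)
qed

lemma cosine_ratio_sum: "a > 0 \<Longrightarrow> b > 0 \<Longrightarrow> cosine_ratio a b (a + b) = -1"
  by (simp add: cosine_ratio_def field_simps power2_eq_square)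

lemma cosine_ratio_ge_minus_one:
  assumes "a > 0" "b > 0" "d \<ge> 0" "d \<le> a + b"
  shows "-1 \<le> cosine_ratio a b d"
proof -
  have "d\<^sup>2 \<le> (a + b)\<^sup>2" using assms by (intro power_mono) auto
  then show ?thesis using assms by (simp add: cosine_ratio_def field_simps power2_eq_square)
qed

lemma cosine_ratio_le_one:
  assumes "a > 0" "b > 0" "\<bar>a - b\<bar> \<le> d"
  shows "cosine_ratio a b d \<le> 1"
proof -
  have "(a - b)\<^sup>2 \<le> d\<^sup>2" using assms(3) by (simp add: abs_le_square_iff[symmetric])
  then show ?thesis using assms by (simp add: cosine_ratio_def field_simps power2_eq_square)
qed

section \<open>Straight angles\<close>

text \<open>Shrinking the sides to zero makes the comparison angle tend to \<^term>\<open>pi\<close>. Since it can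
  only decrease on the way, it is already \<^term>\<open>pi\<close> for the given sides, and the comparison
  triangle is degenerate.\<close>

lemma angle_pi_imp_straight:
  fixes c1 c2 :: "real \<Rightarrow> 'a::metric_space"
  assumes "CAT0 TYPE('a)"
    and c1: "geodesic_on {0..a} c1" and c2: "geodesic_on {0..b} c2" and o: "c1 0 = c2 0"
    and "has_angle c1 c2 pi" and "a \<ge> 0" "b \<ge> 0"
  shows "dist (c1 a) (c2 b) = a + b"
proof -
  have da: "dist (c1 0) (c1 s) = s" if "0 \<le> s" "s \<le> a" for s
    using c1 that by (auto simp: geodesic_on_def)
  have db: "dist (c1 0) (c2 t) = t" if "0 \<le> t" "t \<le> b" for t
    using c2 that by (auto simp: geodesic_on_def o)
  show ?thesis
  proof (cases "a = 0 \<or> b = 0")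
    case True
    then show ?thesis using da[of a] db[of b] o assms(6,7) by (auto simp: dist_commute)
  next
    case False
    then have ab: "a > 0" "b > 0" using assms by auto
    let ?K = "cosine_ratio a b (dist (c1 a) (c2 b))"
    have upper: "dist (c1 a) (c2 b) \<le> a + b"
      using dist_triangle3[of "c1 a" "c2 b" "c1 0"] da[of a] db[of b] ab by simp
    have K: "-1 \<le> ?K"
      using upper ab by (intro cosine_ratio_ge_minus_one) auto
    have le: "comparison_angle (c1 0) (c1 s) (c2 t) \<le> arccos ?K"
      if s: "0 < s" "s \<le> a" and t: "0 < t" "t \<le> b" for s t
    proof -
      have "c1 0 \<noteq> c1 s" "c1 0 \<noteq> c2 t"
        using da[of s] db[of t] s t by (metis dist_self less_irrefl less_imp_le)+
      then have "comparison_angle (c1 0) (c1 s) (c2 t) = arccos (cosine_ratio s t (dist (c1 s) (c2 t)))"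
        using da db s t by (simp add: comparison_angle_eq)
      moreover have "cosine_ratio s t (dist (c1 s) (c2 t)) \<le> 1"
        using dist_triangle2[of "c1 0" "c1 s" "c2 t"] dist_triangle[of "c1 0" "c2 t" "c1 s"] da[of s] db[of t] s t
        by (intro cosine_ratio_le_one) (auto simp: dist_commute)
      ultimately show ?thesis
        using CAT0_hinge_comparison[OF assms(1) c1 c2 o s t] K by (simp add: arccos_le_arccos)
    qed
    have "eventually (\<lambda>s. 0 < s \<and> s \<le> a) (at_right 0)" "eventually (\<lambda>t. 0 < t \<and> t \<le> b) (at_right 0)"
      using ab by (auto simp: eventually_at_right_field intro: exI[of _ a] exI[of _ b])
    then have "eventually (\<lambda>(s, t). comparison_angle (c1 0) (c1 s) (c2 t) \<le> arccos ?K)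
        (at_right 0 \<times>\<^sub>F at_right 0)"
      unfolding eventually_prod_filter using le by blast
    then have "pi \<le> arccos ?K"
      using assms(5) unfolding has_angle_def
      by (intro tendsto_upperbound) (auto simp: case_prod_beta' prod_filter_eq_bot)
    moreover have "?K \<le> 1"
      using dist_triangle2[of "c1 0" "c1 a" "c2 b"] dist_triangle[of "c1 0" "c2 b" "c1 a"] da[of a] db[of b] ab
      by (intro cosine_ratio_le_one) (auto simp: dist_commute)
    ultimately have "cos pi \<ge> cos (arccos ?K)"
      using K arccos_bounded by (intro cos_monotone_0_pi_le) auto
    then have "?K \<le> -1"
      using K \<open>?K \<le> 1\<close> by simp
    then show ?thesis
      using cosine_ratio_le_minus_one[OF ab, of "dist (c1 a) (c2 b)"] upper by simp
  qed
qed

definition between_pts :: "'a::metric_space \<Rightarrow> 'a \<Rightarrow> 'a \<Rightarrow> bool" where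
  "between_pts x y z \<longleftrightarrow> dist x z = dist x y + dist y z"

definition aligned :: "'a::metric_space \<Rightarrow> 'a \<Rightarrow> 'a \<Rightarrow> 'a \<Rightarrow> bool" where
  "aligned x y z w \<longleftrightarrow> dist x w = dist x y + dist y z + dist z w"

text \<open>The concatenation of geodesics from \<^term>\<open>x\<close> to \<^term>\<open>y\<close> and from
  \<^term>\<open>y\<close> to \<^term>\<open>z\<close>.\<close>

lemma geodesic_through:
  fixes x y z :: "'a::metric_space"
  assumes "geodesic_space TYPE('a)" and "between_pts x y z"
  shows "\<exists>c. geodesic_joining c x z \<and> c (dist x y) = y"
proof -
  let ?a = "dist x y"
  obtain c1 c2 where c1: "geodesic_joining c1 x y" and c2: "geodesic_joining c2 y z"
    using assms(1) unfolding geodesic_space_def by blast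
  define c where "c t = (if t \<le> ?a then c1 t else c2 (t - ?a))" for t
  have c1d: "dist (c1 s) (c1 t) = \<bar>s - t\<bar>" if "0 \<le> s" "s \<le> ?a" "0 \<le> t" "t \<le> ?a" for s t
    using c1 that by (auto simp: geodesic_joining_def geodesic_on_def)
  have c2d: "dist (c2 s) (c2 t) = \<bar>s - t\<bar>"
    if "0 \<le> s" "s \<le> dist y z" "0 \<le> t" "t \<le> dist y z" for s t
    using c2 that by (auto simp: geodesic_joining_def geodesic_on_def)
  have ends: "c1 0 = x" "c1 ?a = y" "c2 0 = y" "c2 (dist y z) = z"
    using c1 c2 by (auto simp: geodesic_joining_def)
  have xz: "dist x z = ?a + dist y z"
    using assms(2) by (simp add: between_pts_def)
  have mixed: "dist (c1 s) (c2 t) = ?a - s + t" if "0 \<le> s" "s \<le> ?a" "0 \<le> t" "t \<le> dist y z" for s t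
  proof -
    have "dist x (c1 s) = s" "dist (c1 s) y = ?a - s" "dist y (c2 t) = t" "dist (c2 t) z = dist y z - t"
      using c1d[of 0 s] c1d[of s ?a] c2d[of 0 t] c2d[of t "dist y z"] that unfolding ends by auto
    then show ?thesis
      using xz dist_triangle[of "c1 s" "c2 t" y] dist_triangle[of x z "c1 s"]
        dist_triangle[of "c1 s" z "c2 t"] by linarith
  qed
  have "dist (c s) (c t) = \<bar>s - t\<bar>" if "s \<le> t" "0 \<le> s" "t \<le> dist x z" for s t
    using that c1d[of s t] c2d[of "s - ?a" "t - ?a"] mixed[of s "t - ?a"] xz
    by (auto simp: c_def)
  then have "geodesic_on {0..dist x z} c"
    unfolding geodesic_on_def
    by (metis abs_minus_commute atLeastAtMost_iff dist_commute nle_le)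
  moreover have "c 0 = x" "c ?a = y"
    using ends by (simp_all add: c_def)
  moreover have "c (dist x z) = z"
  proof (cases "y = z")
    case True
    then show ?thesis using \<open>c ?a = y\<close> by simp
  next
    case False
    then show ?thesis using xz ends(4) by (simp add: c_def)
  qed
  ultimately show ?thesis
    unfolding geodesic_joining_def by (intro exI[of _ c] conjI)
qed

text \<open>This is how local geodesics become global ones. In the comparison triangle of \<^term>\<open>z\<close>,
  \<^term>\<open>x\<close>, \<^term>\<open>w\<close>, mark the point of the side from \<^term>\<open>z\<close> to
  \<^term>\<open>x\<close> that corresponds to \<^term>\<open>y\<close>. The distances already add up for
  \<^term>\<open>y\<close>, \<^term>\<open>z\<close>, \<^term>\<open>w\<close>, so the angle of that triangle at \<^term>\<open>z\<close>
  is at least, hence equal to, \<^term>\<open>pi\<close>.\<close>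

lemma between_pts_overlap:
  fixes x y z w :: "'a::metric_space"
  assumes X: "CAT0 TYPE('a)"
    and xyz: "between_pts x y z" and yzw: "between_pts y z w" and "y \<noteq> z"
  shows "aligned x y z w"
proof -
  have gs: "geodesic_space TYPE('a)" using X by (simp add: CAT0_def)
  have "between_pts z y x"
    using xyz by (simp add: between_pts_def dist_commute)
  then obtain c1 where c1: "geodesic_joining c1 z x" and y: "c1 (dist z y) = y"
    using geodesic_through[OF gs] by blast
  obtain c2 where c2: "geodesic_joining c2 z w"
    using gs unfolding geodesic_space_def by blast
  show ?thesis
  proof (cases "z = w")
    case True
    then show ?thesis using xyz by (simp add: aligned_def between_pts_def)
  next
    case False
    have zy: "0 < dist z y" "dist z y \<le> dist z x"
      using \<open>y \<noteq> z\<close> xyz by (auto simp: between_pts_def dist_commute)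
    have "cosine_ratio (dist z x) (dist z w) (dist x w) \<le> cosine_ratio (dist z y) (dist z w) (dist y w)"
      using CAT0_hinge_comparison[OF X, of "dist z x" c1 "dist z w" c2 "dist z y" "dist z w"]
        c1 c2 y zy False by (simp add: geodesic_joining_def)
    also have "\<dots> = -1"
      using yzw cosine_ratio_sum zy False by (simp add: between_pts_def dist_commute)
    finally have "dist z x + dist z w \<le> dist x w"
      using zy False by (intro cosine_ratio_le_minus_one) auto
    then show ?thesis
      using xyz dist_triangle[of x w z] by (auto simp: aligned_def between_pts_def dist_commute)
  qed
qed

lemma aligned_imp_between_pts:
  assumes "aligned x y z w"
  shows "between_pts x y z" "between_pts y z w" "between_pts x z w" "between_pts x y w"
proof -
  note tri = dist_triangle[of x w z] dist_triangle[of x z y] dist_triangle[of x w y]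
    dist_triangle[of y w z]
  show "between_pts x y z" "between_pts y z w"
    using assms tri unfolding aligned_def between_pts_def by linarith+
  show "between_pts x z w"
    using assms tri unfolding aligned_def between_pts_def by linarith
  show "between_pts x y w"
    using assms tri unfolding aligned_def between_pts_def by linarith
qed

lemma aligned_sym: "aligned x y z w \<Longrightarrow> aligned w z y x"
  by (simp add: aligned_def dist_commute)

lemma aligned_isometry: "isometry g \<Longrightarrow> aligned (g x) (g y) (g z) (g w) \<longleftrightarrow> aligned x y z w"
  by (simp add: aligned_def isometry_def)

section \<open>Groups in which reduced words are nontrivial\<close>

definition letter_value :: "('g, 'm) monoid_scheme \<Rightarrow> bool \<times> 'g \<Rightarrow> 'g" where
  "letter_value G l = (if fst l then snd l else inv\<^bsub>G\<^esub> (snd l))"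

definition inverse_letter :: "bool \<times> 'g \<Rightarrow> bool \<times> 'g" where
  "inverse_letter l = (\<not> fst l, snd l)"

lemma inverse_letter_simps [simp]:
  "inverse_letter (inverse_letter l) = l" "snd (inverse_letter l) = snd l"
  "fst (inverse_letter l) = (\<not> fst l)"
  by (simp_all add: inverse_letter_def)

lemma inverse_letter_eq_iff [simp]: "inverse_letter l = inverse_letter m \<longleftrightarrow> l = m"
  by (auto simp: inverse_letter_def prod_eq_iff)

lemma reduced_word_iff:
  fixes w :: "(bool \<times> 'g) list"
  shows "reduced_word w \<longleftrightarrow> successively (\<lambda>l m. m \<noteq> inverse_letter l) w"
proof -
  have "(\<lambda>(e, x :: 'g) (f, y). \<not> (x = y \<and> e \<noteq> f)) = (\<lambda>l m. m \<noteq> inverse_letter l)"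
    by (auto simp: fun_eq_iff inverse_letter_def)
  then show ?thesis by (simp only: reduced_word_def)
qed

lemma word_value_Nil [simp]: "word_value G [] = \<one>\<^bsub>G\<^esub>"
  by (simp add: word_value_def)

lemma word_value_Cons [simp]: "word_value G (l # w) = letter_value G l \<otimes>\<^bsub>G\<^esub> word_value G w"
  by (simp add: word_value_def letter_value_def split: prod.split)

context group
begin

lemma letter_value_closed [simp]: "snd l \<in> carrier G \<Longrightarrow> letter_value G l \<in> carrier G"
  by (simp add: letter_value_def)

lemma letter_value_inverse [simp]:
  "snd l \<in> carrier G \<Longrightarrow> letter_value G (inverse_letter l) = inv (letter_value G l)"
  by (simp add: letter_value_def)

lemma word_value_closed: "snd ` set w \<subseteq> carrier G \<Longrightarrow> word_value G w \<in> carrier G"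
  by (induction w) auto

lemma word_value_append:
  "snd ` set w \<subseteq> carrier G \<Longrightarrow> snd ` set w' \<subseteq> carrier G \<Longrightarrow>
    word_value G (w @ w') = word_value G w \<otimes> word_value G w'"
  by (induction w) (auto simp: word_value_closed m_assoc)

lemma word_value_inverse:
  "snd ` set w \<subseteq> carrier G \<Longrightarrow>
    word_value G (map inverse_letter (rev w)) = inv (word_value G w)"
proof (induction w)
  case (Cons l w)
  then show ?case
    by (subst rev.simps, subst map_append, subst word_value_append)
      (auto simp: word_value_closed inv_mult_group)
qed simp

text \<open>Prefixing a letter to a reduced word either keeps it reduced or cancels its first letter.\<close>

lemma exists_reduced_word:
  assumes "snd ` set w \<subseteq> B" "B \<subseteq> carrier G"
  shows "\<exists>r. reduced_word r \<and> snd ` set r \<subseteq> B \<and> word_value G r = word_value G w"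
  using assms(1)
proof (induction w)
  case Nil
  then show ?case by (intro exI[of _ "[]"]) (simp add: reduced_word_def)
next
  case (Cons l w)
  then obtain r where r: "reduced_word r" "snd ` set r \<subseteq> B" "word_value G r = word_value G w"
    by auto
  show ?case
  proof (cases "\<exists>r'. r = inverse_letter l # r'")
    case True
    then obtain r' where r': "r = inverse_letter l # r'" by blast
    have "snd l \<in> carrier G" "snd ` set r' \<subseteq> carrier G"
      using Cons.prems r r' assms(2) by auto
    then have "word_value G (l # w) = word_value G r'"
      using r(3) r' by (simp add: word_value_closed m_assoc[symmetric] flip: r(3))
    moreover have "reduced_word r'"
      using r(1) r' by (cases r') (auto simp: reduced_word_iff)
    ultimately show ?thesis
      using r r' by auto
  next
    case False
    then have "reduced_word (l # r)"
      using r(1) by (cases r) (auto simp: reduced_word_iff)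
    then show ?thesis
      using r Cons.prems by (intro exI[of _ "l # r"]) auto
  qed
qed

lemma word_values_eq_generate:
  assumes "B \<subseteq> carrier G"
  shows "word_value G ` {w. snd ` set w \<subseteq> B} = generate G B"
proof (intro equalityI subsetI)
  fix h assume "h \<in> generate G B"
  then show "h \<in> word_value G ` {w. snd ` set w \<subseteq> B}"
  proof (induction h)
    case one
    then show ?case by (intro image_eqI[of _ _ "[]"]) auto
  next
    case (incl h)
    then show ?case
      using assms by (intro image_eqI[of _ _ "[(True, h)]"]) (auto simp: letter_value_def)
  next
    case (inv h)
    then show ?case
      using assms by (intro image_eqI[of _ _ "[(False, h)]"]) (auto simp: letter_value_def)
  next
    case (eng h1 h2)
    then obtain w1 w2 where "snd ` set w1 \<subseteq> B" "h1 = word_value G w1"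
      "snd ` set w2 \<subseteq> B" "h2 = word_value G w2" by auto
    then show ?case
      using assms by (intro image_eqI[of _ _ "w1 @ w2"]) (auto simp: word_value_append)
  qed
next
  fix h assume "h \<in> word_value G ` {w. snd ` set w \<subseteq> B}"
  then obtain w where "snd ` set w \<subseteq> B" "h = word_value G w" by auto
  then show "h \<in> generate G B"
    by (induction w arbitrary: h)
      (auto simp: letter_value_def intro: generate.intros)
qed

text \<open>After cancelling the common prefix of two different reduced words \<open>w\<close> and
  \<open>w'\<close> with the same value, the concatenation of the inverse of \<open>w\<close> with \<open>w'\<close> is
  reduced, nonempty and has trivial value.\<close>

lemma inj_on_reduced_words:
  assumes B: "B \<subseteq> carrier G"
    and nontrivial: "\<And>w. reduced_word w \<Longrightarrow> snd ` set w \<subseteq> B \<Longrightarrow> w \<noteq> [] \<Longrightarrow> word_value G w \<noteq> \<one>"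
  shows "inj_on (word_value G) {w. reduced_word w \<and> snd ` set w \<subseteq> B}"
proof -
  have "w = w'"
    if "reduced_word w" "snd ` set w \<subseteq> B" "reduced_word w'" "snd ` set w' \<subseteq> B"
      "word_value G w = word_value G w'" for w w'
    using that
  proof (induction w arbitrary: w')
    case Nil
    then show ?case using nontrivial[of w'] by force
  next
    case (Cons l w)
    note carrier = subset_trans[OF Cons.prems(2) B] subset_trans[OF Cons.prems(4) B]
    show ?case
    proof (cases w')
      case Nil
      then show ?thesis using nontrivial[of "l # w"] Cons.prems by force
    next
      case w': (Cons m v)
      show ?thesis
      proof (cases "l = m")
        case True
        have "word_value G w = word_value G v"
          using Cons.prems(5) carrier unfolding w' True
          by (simp add: word_value_closed)
        moreover have "reduced_word w" "reduced_word v"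
          using Cons.prems w' by (cases w; cases v; auto simp: reduced_word_iff)+
        ultimately show ?thesis
          using Cons.IH[of v] Cons.prems w' True by auto
      next
        case False
        define z where "z = map inverse_letter (rev (l # w)) @ w'"
        have "word_value G z = \<one>"
          unfolding z_def
          using carrier Cons.prems(5) word_value_inverse[OF carrier(1)] word_value_closed[OF carrier(2)]
          by (subst word_value_append) auto
        moreover have "reduced_word z"
        proof -
          have "successively (\<lambda>l m. m \<noteq> inverse_letter l) (map inverse_letter (rev (l # w)))"
            using Cons.prems(1) unfolding reduced_word_iff successively_map successively_rev
            by (rule successively_mono) auto
          then show ?thesis
            using Cons.prems(3) False w' unfolding reduced_word_iff z_def successively_append_iff
            by (auto simp: last_map)
        qed
        moreover have "snd ` set z \<subseteq> B" "z \<noteq> []"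
          using Cons.prems by (auto simp: z_def)
        ultimately show ?thesis using nontrivial by blast
      qed
    qed
  qed
  then show ?thesis by (auto intro!: inj_onI)
qed

lemma free_basis_subgroup_generated:
  assumes B: "B \<subseteq> carrier G"
    and nontrivial: "\<And>w. reduced_word w \<Longrightarrow> snd ` set w \<subseteq> B \<Longrightarrow> w \<noteq> [] \<Longrightarrow> word_value G w \<noteq> \<one>"
  shows "free_basis (subgroup_generated G B) B"
proof -
  let ?H = "subgroup_generated G B" and ?R = "{w. reduced_word w \<and> snd ` set w \<subseteq> B}"
  have carrier: "carrier ?H = generate G B"
    using B by (simp add: carrier_subgroup_generated Int_absorb1)
  have BH: "B \<subseteq> carrier ?H"
    unfolding carrier by (auto intro: generate.incl)
  have same: "word_value ?H w = word_value G w" if "snd ` set w \<subseteq> B" for w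
    using that
  proof (induction w)
    case (Cons l w)
    then have "letter_value ?H l = letter_value G l"
      using BH by (auto simp: letter_value_def inv_subgroup_generated)
    then show ?case using Cons by simp
  qed simp
  have "word_value G ` ?R = generate G B"
    unfolding word_values_eq_generate[OF B, symmetric]
  proof (intro equalityI subsetI)
    fix h assume "h \<in> word_value G ` {w. snd ` set w \<subseteq> B}"
    then show "h \<in> word_value G ` ?R"
      using exists_reduced_word[OF _ B] by (auto simp: image_iff) metis
  qed auto
  moreover have "word_value ?H ` ?R = word_value G ` ?R"
    using same by (intro image_cong) auto
  moreover have "inj_on (word_value ?H) ?R"
    using inj_on_reduced_words[OF B nontrivial] by (subst inj_on_cong[of _ _ "word_value G"]) (auto simp: same)
  ultimately show ?thesis
    using BH by (simp add: free_basis_def bij_betw_def carrier)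
qed

end

section \<open>Ping-pong along geodesics\<close>

lemma isometry_group_simps [simp]:
  "carrier isometry_group = {g. isometry g}" "f \<otimes>\<^bsub>isometry_group\<^esub> g = f \<circ> g" "\<one>\<^bsub>isometry_group\<^esub> = id"
  by (simp_all add: isometry_group_def)

lemma isometry_inverse:
  assumes "isometry g"
  shows "isometry (inv\<^bsub>isometry_group\<^esub> g)"
    and "(inv\<^bsub>isometry_group\<^esub> g) (g x) = x" and "g ((inv\<^bsub>isometry_group\<^esub> g) x) = x"
proof -
  interpret group "isometry_group :: ('a \<Rightarrow> 'a) monoid" by (rule group_isometry_group)
  show "isometry (inv\<^bsub>isometry_group\<^esub> g)"
    using inv_closed[of g] assms by simp
  have "inv\<^bsub>isometry_group\<^esub> g \<circ> g = id" "g \<circ> inv\<^bsub>isometry_group\<^esub> g = id"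
    using l_inv[of g] r_inv[of g] assms by simp_all
  then show "(inv\<^bsub>isometry_group\<^esub> g) (g x) = x" "g ((inv\<^bsub>isometry_group\<^esub> g) x) = x"
    by (metis comp_apply id_apply)+
qed

lemma isometry_letter_value:
  assumes "isometry (snd l)"
  shows "isometry (letter_value isometry_group l)"
    and "letter_value isometry_group l (letter_value isometry_group (inverse_letter l) x) = x"
  using isometry_inverse[OF assms] assms by (auto simp: letter_value_def)

text \<open>Every nonempty reduced word over \<^term>\<open>B\<close> that starts with \<^term>\<open>l\<close> moves a
  suitable point \<^term>\<open>u m\<close> beyond the spoke of \<^term>\<open>l\<close>. The spokes with
  inner ends \<^term>\<open>u m\<close> and outer ends \<^term>\<open>v m\<close> are indexed by letters; as \<^term>\<open>l\<close>
  maps \<^term>\<open>v (inverse_letter l)\<close> to \<^term>\<open>u l\<close> and \<^term>\<open>u (inverse_letter l)\<close> to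
  \<^term>\<open>v l\<close>, it turns the spoke of its inverse into its own, reversed.

  In the induction step the word continues with a letter \<^term>\<open>m\<close> different from the inverse
  of \<^term>\<open>l\<close>. So the spoke of that inverse is aligned with the spoke of \<^term>\<open>m\<close>, and applying
  \<^term>\<open>l\<close> shows that the spoke of \<^term>\<open>l\<close> is aligned with the translated spoke of
  \<^term>\<open>m\<close>. The induction hypothesis continues the geodesic beyond the latter, and the two pieces
  overlap in that spoke.\<close>

lemma reduced_words_move_spokes:
  fixes B :: "('a::metric_space \<Rightarrow> 'a) set" and u v :: "bool \<times> ('a \<Rightarrow> 'a) \<Rightarrow> 'a"
  assumes X: "CAT0 TYPE('a)" and B: "\<And>g. g \<in> B \<Longrightarrow> isometry g"
    and v: "\<And>l. snd l \<in> B \<Longrightarrow> v l = letter_value isometry_group l (u (inverse_letter l))"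
    and ne: "\<And>l. snd l \<in> B \<Longrightarrow> u l \<noteq> v l"
    and spokes: "\<And>l m. snd l \<in> B \<Longrightarrow> snd m \<in> B \<Longrightarrow> l \<noteq> m \<Longrightarrow> aligned (v l) (u l) (u m) (v m)"
    and "reduced_word (l # w)" "snd ` set (l # w) \<subseteq> B"
  shows "between_pts (u l) (v l)
    (word_value isometry_group (l # w) (u (inverse_letter (last (l # w)))))"
  using assms(6,7)
proof (induction w arbitrary: l)
  case Nil
  then show ?case using v[of l] by (simp add: between_pts_def)
next
  case (Cons m w)
  let ?f = "letter_value isometry_group l"
  define e where "e = word_value isometry_group (m # w) (u (inverse_letter (last (m # w))))"
  have lm: "snd l \<in> B" "snd m \<in> B" "m \<noteq> inverse_letter l"
    using Cons.prems by (auto simp: reduced_word_iff)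
  have iso: "isometry ?f" "\<And>x. ?f (letter_value isometry_group (inverse_letter l) x) = x"
    using isometry_letter_value[of l] B lm by auto
  have "between_pts (u m) (v m) e"
    unfolding e_def using Cons by (intro Cons.IH) (auto simp: reduced_word_iff)
  then have ahead: "between_pts (?f (u m)) (?f (v m)) (?f e)"
    using iso(1) by (simp add: between_pts_def isometry_def)
  have "aligned (v (inverse_letter l)) (u (inverse_letter l)) (u m) (v m)"
    using lm by (intro spokes) auto
  then have "aligned (?f (v (inverse_letter l))) (?f (u (inverse_letter l))) (?f (u m)) (?f (v m))"
    using iso(1) by (simp add: aligned_isometry)
  then have turn: "aligned (u l) (v l) (?f (u m)) (?f (v m))"
    using v[of l] v[of "inverse_letter l"] iso(2) lm by simp
  have "?f (u m) \<noteq> ?f (v m)"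
    using ne[OF lm(2)] iso(1) by (metis dist_eq_0_iff isometry_def)
  then have "aligned (u l) (?f (u m)) (?f (v m)) (?f e)"
    using between_pts_overlap[OF X aligned_imp_between_pts(3)[OF turn] ahead] by simp
  then have "between_pts (u l) (?f (u m)) (?f e)"
    by (rule aligned_imp_between_pts(4))
  moreover have "between_pts (u l) (v l) (?f (u m))"
    by (rule aligned_imp_between_pts(1)[OF turn])
  ultimately have "between_pts (u l) (v l) (?f e)"
    using dist_triangle[of "u l" "?f e" "v l"] dist_triangle[of "v l" "?f e" "?f (u m)"]
    unfolding between_pts_def by linarith
  then show ?case by (simp add: e_def)
qed

text \<open>If a reduced word were trivial, some inner end \<^term>\<open>u m\<close> would lie beyond
  \<^term>\<open>v l\<close> as seen from \<^term>\<open>u l\<close>; but \<^term>\<open>u l\<close> lies between \<^term>\<open>v l\<close> and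
  \<^term>\<open>u m\<close>.\<close>

lemma spokes_imp_free_basis:
  fixes B :: "('a::metric_space \<Rightarrow> 'a) set" and u v :: "bool \<times> ('a \<Rightarrow> 'a) \<Rightarrow> 'a"
  assumes X: "CAT0 TYPE('a)" and B: "\<And>g. g \<in> B \<Longrightarrow> isometry g"
    and v: "\<And>l. snd l \<in> B \<Longrightarrow> v l = letter_value isometry_group l (u (inverse_letter l))"
    and ne: "\<And>l. snd l \<in> B \<Longrightarrow> u l \<noteq> v l"
    and spokes: "\<And>l m. snd l \<in> B \<Longrightarrow> snd m \<in> B \<Longrightarrow> l \<noteq> m \<Longrightarrow> aligned (v l) (u l) (u m) (v m)"
  shows "free_basis (subgroup_generated isometry_group B) B"
proof (rule group.free_basis_subgroup_generated[OF group_isometry_group])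
  show "B \<subseteq> carrier isometry_group" using B by auto
next
  fix w assume w: "reduced_word w" "snd ` set w \<subseteq> B" "w \<noteq> []"
  show "word_value isometry_group w \<noteq> \<one>\<^bsub>isometry_group\<^esub>"
  proof
    assume "word_value isometry_group w = \<one>\<^bsub>isometry_group\<^esub>"
    moreover obtain l w' where lw: "w = l # w'" using w(3) by (cases w) auto
    moreover define m where "m = inverse_letter (last w)"
    ultimately have btw: "between_pts (u l) (v l) (u m)"
      using reduced_words_move_spokes[where l = l and w = w', OF X B v ne spokes] w by simp
    have lm: "snd l \<in> B" "snd m \<in> B"
      using w lw last_in_set[OF w(3)] by (auto simp: m_def)
    have "dist (u l) (v l) > 0" using ne[OF lm(1)] by simp
    moreover have "l = m \<or> between_pts (v l) (u l) (u m)"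
      using spokes[OF lm] aligned_imp_between_pts(1) by blast
    ultimately show False
      using btw by (auto simp: between_pts_def dist_commute)
  qed
qed

section \<open>Two translated lines\<close>

text \<open>The parameters in \<^term>\<open>{0..L}\<close> describe the core of a line; what remains are two rays,
  and \<^term>\<open>arm L up s\<close> is the parameter at distance \<^term>\<open>s\<close> from the core on one of them.\<close>

definition arm :: "real \<Rightarrow> bool \<Rightarrow> real \<Rightarrow> real" where
  "arm L up s = (if up then L + s else - s)"

text \<open>The spoke of a letter is the initial piece, of length the translation length minus
  \<^term>\<open>L\<close>, of the ray towards which the letter translates: the other end of the core is moved onto
  its outer end. With \<^term>\<open>L = 0\<close> this also covers two disjoint lines joined by a bridge.\<close>

lemma free_group_of_two_lines:
  fixes g1 g2 :: "'a::metric_space \<Rightarrow> 'a" and c1 c2 :: "real \<Rightarrow> 'a"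
  assumes X: "CAT0 TYPE('a)" and iso: "isometry g1" "isometry g2"
    and line: "geodesic_on UNIV c1" "geodesic_on UNIV c2"
    and trans: "\<And>t. g1 (c1 t) = c1 (t + \<tau>1)" "\<And>t. g2 (c2 t) = c2 (t + \<tau>2)"
    and L: "0 \<le> L" "L < \<bar>\<tau>1\<bar>" "L < \<bar>\<tau>2\<bar>"
    and tree: "\<And>p q s t. 0 \<le> s \<Longrightarrow> 0 \<le> t \<Longrightarrow>
      aligned (c1 (arm L p s)) (c1 (arm L p 0)) (c2 (arm L q 0)) (c2 (arm L q t))"
  shows "free_group (subgroup_generated isometry_group {g1, g2})"
proof -
  have d: "dist (c1 s) (c1 t) = \<bar>s - t\<bar>" "dist (c2 s) (c2 t) = \<bar>s - t\<bar>" for s t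
    using line by (simp_all add: geodesic_on_UNIV_dist)
  have shift: "arm L (\<not> (\<tau> > 0)) 0 + \<tau> = arm L (\<tau> > 0) (\<bar>\<tau>\<bar> - L)"
    "arm L (\<not> (\<tau> > 0)) (\<bar>\<tau>\<bar> - L) + \<tau> = arm L (\<tau> > 0) 0" if "L < \<bar>\<tau>\<bar>" for \<tau>
    using that L(1) by (auto simp: arm_def)
  \<comment> \<open>A common isometry would map the two inner ends of the spokes of the inverse letters to the outer
    ends of its own spokes, which are strictly farther apart than the inner ends of the latter. So the
    distance of inner ends is larger for the inverse letters, and by symmetry also smaller.\<close>
  have "g1 \<noteq> g2"
  proof
    assume eq: "g1 = g2"
    let ?P = "\<tau>1 > 0" and ?Q = "\<tau>2 > 0"
    let ?r1 = "\<bar>\<tau>1\<bar> - L" and ?r2 = "\<bar>\<tau>2\<bar> - L"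
    let ?D = "\<lambda>p q. dist (c1 (arm L p 0)) (c2 (arm L q 0))"
    have D: "dist (c1 (arm L p ?r1)) (c2 (arm L q ?r2)) = ?r1 + ?D p q + ?r2" for p q
      using tree[of ?r1 ?r2 p q] L by (simp add: aligned_def d) (simp add: arm_def)
    have same: "dist (g1 x) (g2 y) = dist x y" for x y
      using iso(1) eq by (simp add: isometry_def)
    have "?D (\<not> ?P) (\<not> ?Q) = ?r1 + ?D ?P ?Q + ?r2"
      using same[of "c1 (arm L (\<not> ?P) 0)" "c2 (arm L (\<not> ?Q) 0)"]
      unfolding trans shift(1)[OF L(2)] shift(1)[OF L(3)] D by simp
    moreover have "?D ?P ?Q = ?r1 + ?D (\<not> ?P) (\<not> ?Q) + ?r2"
      using same[of "c1 (arm L (\<not> ?P) ?r1)" "c2 (arm L (\<not> ?Q) ?r2)"]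
      unfolding trans shift(2)[OF L(2)] shift(2)[OF L(3)] D by simp
    ultimately show False using L by linarith
  qed
  define c where "c g = (if g = g1 then c1 else c2)" for g
  define \<tau> where "\<tau> g = (if g = g1 then \<tau>1 else \<tau>2)" for g
  define up where "up l \<longleftrightarrow> (fst l \<longleftrightarrow> \<tau> (snd l) > 0)" for l :: "bool \<times> ('a \<Rightarrow> 'a)"
  define r where "r g = \<bar>\<tau> g\<bar> - L" for g
  define u where "u l = c (snd l) (arm L (up l) 0)" for l
  define v where "v l = c (snd l) (arm L (up l) (r (snd l)))" for l
  have dc: "dist (c g s) (c g t) = \<bar>s - t\<bar>" for g s t
    by (simp add: c_def d)
  have r: "r g > 0" for g
    using L by (simp add: r_def \<tau>_def)
  have move: "letter_value isometry_group l (c (snd l) t) =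
      c (snd l) (t + (if fst l then \<tau> (snd l) else - \<tau> (snd l)))" if "snd l \<in> {g1, g2}" for l t
  proof -
    let ?g = "snd l"
    have g: "isometry ?g" "\<And>t. ?g (c ?g t) = c ?g (t + \<tau> ?g)"
      using that iso trans by (auto simp: c_def \<tau>_def)
    have "(inv\<^bsub>isometry_group\<^esub> ?g) (c ?g t) = c ?g (t - \<tau> ?g)"
      using isometry_inverse(2)[OF g(1), of "c ?g (t - \<tau> ?g)"] g(2)[of "t - \<tau> ?g"] by simp
    then show ?thesis by (simp add: letter_value_def g(2))
  qed
  have "free_basis (subgroup_generated isometry_group {g1, g2}) {g1, g2}"
  proof (rule spokes_imp_free_basis[OF X, where u = u and v = v])
    show "isometry g" if "g \<in> {g1, g2}" for g using that iso by auto
  next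
    fix l :: "bool \<times> ('a \<Rightarrow> 'a)" assume l: "snd l \<in> {g1, g2}"
    show "v l = letter_value isometry_group l (u (inverse_letter l))"
    proof -
      have "arm L (up (inverse_letter l)) 0 + (if fst l then \<tau> (snd l) else - \<tau> (snd l))
          = arm L (up l) (r (snd l))"
        using r[of "snd l"] L(1) by (auto simp: arm_def up_def r_def)
      then show ?thesis
        using move[OF l] by (simp add: u_def v_def)
    qed
    have "dist (u l) (v l) = r (snd l)"
      using r[of "snd l"] by (simp add: u_def v_def dc arm_def)
    then show "u l \<noteq> v l"
      using r[of "snd l"] by auto
  next
    fix l m :: "bool \<times> ('a \<Rightarrow> 'a)"
    assume l: "snd l \<in> {g1, g2}" and m: "snd m \<in> {g1, g2}" and "l \<noteq> m"
    show "aligned (v l) (u l) (u m) (v m)"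
    proof (cases "snd l = snd m")
      case True
      then have "up l \<noteq> up m" using \<open>l \<noteq> m\<close> by (auto simp: up_def prod_eq_iff)
      then show ?thesis
        using r[of "snd m"] L(1) by (auto simp: aligned_def u_def v_def dc True arm_def)
    next
      case False
      have cross: "aligned (v l) (u l) (u m) (v m)" if "snd l = g1" "snd m = g2" for l m
        using tree[of "r g1" "r g2" "up l" "up m"] r[of g1] r[of g2] \<open>g1 \<noteq> g2\<close> that
        by (simp add: u_def v_def c_def)
      show ?thesis
        using False l m cross[of l m] aligned_sym[OF cross[of m l]] by auto
    qed
  qed
  moreover have "group (subgroup_generated isometry_group {g1, g2})"
    by (intro group.group_subgroup_generated group_isometry_group)
  ultimately show ?thesis
    unfolding free_group_def by blast
qed

section \<open>The two configurations\<close>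

text \<open>The direction of the parametrisation is fixed by two points of the axis, not by the
  translation; therefore \<^term>\<open>\<tau>\<close> may be negative.\<close>

lemma axis_parametrisation:
  assumes "is_axis g A" "x \<in> A" "y \<in> A"
  obtains c \<tau> where "isometry g" "geodesic_on UNIV c" "A = range c" "\<And>t. g (c t) = c (t + \<tau>)"
    "\<tau> \<noteq> 0" "translation_length g A = \<bar>\<tau>\<bar>" "c 0 = x" "c (dist x y) = y"
proof -
  obtain l where l: "l > 0" "translates_line g A l"
    using assms(1) by (auto simp: is_axis_def)
  then obtain c0 \<tau>0 where c0: "geodesic_on UNIV c0" "A = range c0"
      "\<And>t. g (c0 t) = c0 (t + \<tau>0)" "l = \<bar>\<tau>0\<bar>"
    by (auto simp: translates_line_def)
  obtain t0 t1 where t: "x = c0 t0" "y = c0 t1" using assms c0 by auto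
  define \<sigma> :: real where "\<sigma> = (if t0 \<le> t1 then 1 else -1)"
  have \<sigma>: "\<sigma> * \<sigma> = 1" "\<bar>\<sigma>\<bar> = 1" by (auto simp: \<sigma>_def)
  have d: "dist (c0 s) (c0 t) = \<bar>s - t\<bar>" for s t
    using c0(1) by (simp add: geodesic_on_UNIV_dist)
  show thesis
  proof (rule that[of "\<lambda>t. c0 (t0 + \<sigma> * t)" "\<sigma> * \<tau>0"])
    show "isometry g" using assms(1) by (simp add: is_axis_def)
    show "geodesic_on UNIV (\<lambda>t. c0 (t0 + \<sigma> * t))"
      using \<sigma> by (simp add: geodesic_on_def d abs_mult flip: right_diff_distrib)
    show "A = range (\<lambda>t. c0 (t0 + \<sigma> * t))"
    proof -
      have "c0 s = c0 (t0 + \<sigma> * (\<sigma> * (s - t0)))" for s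
        using \<sigma> by (simp flip: mult.assoc)
      then show ?thesis unfolding c0(2) by blast
    qed
    show "g (c0 (t0 + \<sigma> * t)) = c0 (t0 + \<sigma> * (t + \<sigma> * \<tau>0))" for t
      using \<sigma> by (simp add: c0(3) distrib_left flip: mult.assoc) (simp add: add.assoc)
    show "\<sigma> * \<tau>0 \<noteq> 0" "translation_length g A = \<bar>\<sigma> * \<tau>0\<bar>"
      using l c0(4) \<sigma> translation_length_eq[OF l(2)] by (auto simp: abs_mult)
    show "c0 (t0 + \<sigma> * 0) = x" "c0 (t0 + \<sigma> * dist x y) = y"
      by (auto simp: t d \<sigma>_def)
  qed
qed

text \<open>A point of a line is determined by its distances to two points \<^term>\<open>x\<close> and
  \<^term>\<open>y\<close> of the line if they add up to \<^term>\<open>dist x y\<close>.\<close>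

lemma segment_in_line:
  assumes S: "geodesic_segment S x y" "S \<subseteq> range c"
    and c: "geodesic_on UNIV c" "c 0 = x" "c (dist x y) = y"
  shows "S = c ` {0..dist x y}"
proof -
  obtain b where b: "geodesic_joining b x y" "S = b ` {0..dist x y}"
    using S by (auto simp: geodesic_segment_def)
  have "b t = c t" if t: "t \<in> {0..dist x y}" for t
  proof -
    obtain s where s: "b t = c s" using S(2) b(2) t by blast
    have ends: "b 0 = x" "b (dist x y) = y" and b_dist: "geodesic_on {0..dist x y} b"
      using b(1) by (auto simp: geodesic_joining_def)
    have "dist (b 0) (b t) = t" "dist (b t) (b (dist x y)) = dist x y - t"
      using b_dist t unfolding geodesic_on_def by force+
    then have "dist x (b t) = t" "dist (b t) y = dist x y - t"
      unfolding ends .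
    then have "\<bar>s\<bar> = t" "\<bar>s - dist x y\<bar> = dist x y - t"
      using geodesic_on_UNIV_dist[OF c(1), of 0 s] geodesic_on_UNIV_dist[OF c(1), of s "dist x y"]
      by (simp_all add: s c)
    then show ?thesis using s t by (cases "s \<ge> 0") auto
  qed
  then show ?thesis unfolding b(2) by (rule image_cong[OF refl])
qed

lemma line_rays:
  assumes "geodesic_on UNIV c"
  shows "geodesic_ray_from (c a) (\<lambda>t. c (a + t))" "geodesic_ray_from (c a) (\<lambda>t. c (a - t))"
  using assms by (auto simp: geodesic_ray_from_def geodesic_on_def)

lemma complementary_rays_of_line:
  assumes c: "geodesic_on UNIV c" and L: "0 \<le> L"
  shows "complementary_rays (range c) (c ` {0..L}) (c 0) (c L) (\<lambda>t. c (- t)) (\<lambda>t. c (L + t))"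
proof -
  have inj: "c s = c t \<longleftrightarrow> s = t" for s t
    using geodesic_on_UNIV_dist[OF c, of s t] by (metis dist_eq_0_iff abs_eq_0_iff diff_self right_minus_eq)
  have "(\<lambda>t. c (- t)) ` {0..} \<inter> c ` {0..L} = {c 0}" "(\<lambda>t. c (L + t)) ` {0..} \<inter> c ` {0..L} = {c L}"
    using L by (auto simp: inj)
  moreover have "range c = (\<lambda>t. c (- t)) ` {0..} \<union> c ` {0..L} \<union> (\<lambda>t. c (L + t)) ` {0..}"
  proof -
    have "c t \<in> (\<lambda>t. c (- t)) ` {0..} \<union> c ` {0..L} \<union> (\<lambda>t. c (L + t)) ` {0..}" for t
      using image_eqI[of "c t" "\<lambda>t. c (- t)" "- t" "{0..}"]
        image_eqI[of "c t" "\<lambda>t. c (L + t)" "t - L" "{0..}"] by fastforce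
    then show ?thesis by auto
  qed
  ultimately show ?thesis
    using line_rays[OF c, of 0] line_rays[OF c, of L] by (simp add: complementary_rays_def)
qed

text \<open>Rays of the two axes on the same side of the segment are straight by hypothesis. Rays on
  opposite sides are joined along the segment: if it is nondegenerate, the two axes overlap in it.\<close>

lemma free_group_of_axes_meeting_in_segment:
  fixes g1 g2 :: "'a::metric_space \<Rightarrow> 'a"
  assumes X: "CAT0 TYPE('a)" and axes: "is_axis g1 A1" "is_axis g2 A2"
    and "axes_meet_in_segment g1 A1 g2 A2"
  shows "free_group (subgroup_generated isometry_group {g1, g2})"
proof -
  obtain x y where S: "geodesic_segment (A1 \<inter> A2) x y"
    and angles: "\<And>r1m r1p r2m r2p. complementary_rays A1 (A1 \<inter> A2) x y r1m r1p \<Longrightarrow>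
        complementary_rays A2 (A1 \<inter> A2) x y r2m r2p \<Longrightarrow> has_angle r1p r2p pi \<and> has_angle r1m r2m pi"
    and short: "dist x y < translation_length g1 A1" "dist x y < translation_length g2 A2"
    using assms(4) unfolding axes_meet_in_segment_def by blast
  define L where "L = dist x y"
  have xy: "x \<in> A1 \<inter> A2" "y \<in> A1 \<inter> A2"
  proof -
    obtain b where b: "A1 \<inter> A2 = b ` {0..dist x y}" and ends: "b 0 = x" "b (dist x y) = y"
      using S by (auto simp: geodesic_segment_def geodesic_joining_def)
    have "b 0 \<in> A1 \<inter> A2" "b (dist x y) \<in> A1 \<inter> A2"
      unfolding b by (rule imageI, simp)+
    then show "x \<in> A1 \<inter> A2" "y \<in> A1 \<inter> A2"
      unfolding ends .
  qed
  obtain c1 \<tau>1 where 1: "isometry g1" "geodesic_on UNIV c1" "A1 = range c1" "\<And>t. g1 (c1 t) = c1 (t + \<tau>1)"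
      "translation_length g1 A1 = \<bar>\<tau>1\<bar>" "c1 0 = x" "c1 L = y"
    using axis_parametrisation[OF axes(1)] xy unfolding L_def by (metis IntD1)
  obtain c2 \<tau>2 where 2: "isometry g2" "geodesic_on UNIV c2" "A2 = range c2" "\<And>t. g2 (c2 t) = c2 (t + \<tau>2)"
      "translation_length g2 A2 = \<bar>\<tau>2\<bar>" "c2 0 = x" "c2 L = y"
    using axis_parametrisation[OF axes(2)] xy unfolding L_def by (metis IntD2)
  have S1: "A1 \<inter> A2 = c1 ` {0..L}" and S2: "A1 \<inter> A2 = c2 ` {0..L}"
    unfolding L_def
    using segment_in_line[OF S _ 1(2,6)] segment_in_line[OF S _ 2(2,6)] 1(3,7) 2(3,7) L_def by simp_all
  have L: "0 \<le> L" by (simp add: L_def)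
  have rays1: "complementary_rays A1 (A1 \<inter> A2) x y (\<lambda>t. c1 (- t)) (\<lambda>t. c1 (L + t))"
    using complementary_rays_of_line[OF 1(2) L] unfolding 1(3)[symmetric] S1[symmetric] 1(6,7) .
  have rays2: "complementary_rays A2 (A1 \<inter> A2) x y (\<lambda>t. c2 (- t)) (\<lambda>t. c2 (L + t))"
    using complementary_rays_of_line[OF 2(2) L] unfolding 2(3)[symmetric] S2[symmetric] 2(6,7) .
  have d: "dist (c1 s) (c1 t) = \<bar>s - t\<bar>" "dist (c2 s) (c2 t) = \<bar>s - t\<bar>" for s t
    using 1 2 by (simp_all add: geodesic_on_UNIV_dist)
  have straight: "dist (r1 s) (r2 t) = s + t"
    if "geodesic_ray_from z r1" "geodesic_ray_from z r2" "has_angle r1 r2 pi" "0 \<le> s" "0 \<le> t"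
    for z :: 'a and r1 r2 s t
    using that angle_pi_imp_straight[OF X, of s r1 t r2]
    by (simp add: geodesic_ray_from_def geodesic_on_def)
  note rays = rays1[unfolded complementary_rays_def] rays2[unfolded complementary_rays_def]
  have opposite: "aligned (c1 (arm L p s)) (c1 (arm L p 0)) (c2 (arm L (\<not> p) 0)) (c2 (arm L (\<not> p) t))"
    if st: "0 \<le> s" "0 \<le> t" for p s t
  proof (cases "x = y")
    case True
    \<comment> \<open>For a single point, the two rays of the second axis can be exchanged.\<close>
    then have "L = 0" by (simp add: L_def)
    have rays2': "complementary_rays A2 (A1 \<inter> A2) x y (\<lambda>t. c2 (L + t)) (\<lambda>t. c2 (- t))"
      using rays2 True \<open>L = 0\<close> by (auto simp: complementary_rays_def)
    have "dist (c1 (L + s)) (c2 (- t)) = s + t" "dist (c1 (- s)) (c2 (L + t)) = s + t"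
      using angles[OF rays1 rays2'] rays st True
        straight[of y "\<lambda>t. c1 (L + t)" "\<lambda>t. c2 (- t)" s t]
        straight[of x "\<lambda>t. c1 (- t)" "\<lambda>t. c2 (L + t)" s t]
      by simp_all
    then show ?thesis
      using st 1 2 d \<open>L = 0\<close> by (auto simp: aligned_def arm_def)
  next
    case False
    have same: "c2 (arm L p 0) = c1 (arm L p 0)" "c2 (arm L (\<not> p) 0) = c1 (arm L (\<not> p) 0)"
      using 1 2 by (simp_all add: arm_def)
    have "between_pts (c1 (arm L p s)) (c1 (arm L p 0)) (c1 (arm L (\<not> p) 0))"
      using st L by (auto simp: between_pts_def d arm_def)
    moreover have "between_pts (c2 (arm L p 0)) (c2 (arm L (\<not> p) 0)) (c2 (arm L (\<not> p) t))"
      using st L by (auto simp: between_pts_def d arm_def)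
    moreover have "c1 (arm L p 0) \<noteq> c1 (arm L (\<not> p) 0)"
      using False 1 by (auto simp: arm_def)
    ultimately show ?thesis
      unfolding same by (intro between_pts_overlap[OF X]) (auto simp: same)
  qed
  show ?thesis
  proof (rule free_group_of_two_lines[OF X 1(1) 2(1) 1(2) 2(2) 1(4) 2(4) L])
    show "L < \<bar>\<tau>1\<bar>" "L < \<bar>\<tau>2\<bar>"
      using short 1(5) 2(5) by (simp_all add: L_def)
  next
    fix p q and s t :: real assume st: "0 \<le> s" "0 \<le> t"
    show "aligned (c1 (arm L p s)) (c1 (arm L p 0)) (c2 (arm L q 0)) (c2 (arm L q t))"
    proof (cases "p = q")
      case False
      then show ?thesis using opposite[OF st, of p] by (cases p) auto
    next
      case True
      have "dist (c1 (L + s)) (c2 (L + t)) = s + t" "dist (c1 (- s)) (c2 (- t)) = s + t"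
        using angles[OF rays1 rays2] rays st
          straight[of y "\<lambda>t. c1 (L + t)" "\<lambda>t. c2 (L + t)" s t]
          straight[of x "\<lambda>t. c1 (- t)" "\<lambda>t. c2 (- t)" s t]
        by simp_all
      then show ?thesis
        using st 1 2 d True by (auto simp: aligned_def arm_def)
    qed
  qed
qed

text \<open>A ray of either axis prolongs the bridge to a geodesic; for rays of different axes, these two
  geodesics overlap in the bridge.\<close>

lemma free_group_of_axes_joined_by_bridge:
  fixes g1 g2 :: "'a::metric_space \<Rightarrow> 'a"
  assumes X: "CAT0 TYPE('a)" and axes: "is_axis g1 A1" "is_axis g2 A2"
    and "axes_joined_by_bridge A1 A2"
  shows "free_group (subgroup_generated isometry_group {g1, g2})"
proof -
  obtain a1 a2 b where disj: "A1 \<inter> A2 = {}" and a: "a1 \<in> A1" "a2 \<in> A2" and b: "geodesic_joining b a1 a2"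
    and angle1: "\<And>r. geodesic_ray_from a1 r \<Longrightarrow> r ` {0..} \<subseteq> A1 \<Longrightarrow> has_angle b r pi"
    and angle2: "\<And>r. geodesic_ray_from a2 r \<Longrightarrow> r ` {0..} \<subseteq> A2 \<Longrightarrow>
        has_angle (\<lambda>t. b (dist a1 a2 - t)) r pi"
    using assms(4) unfolding axes_joined_by_bridge_def by blast
  obtain c1 \<tau>1 where 1: "isometry g1" "geodesic_on UNIV c1" "A1 = range c1" "\<And>t. g1 (c1 t) = c1 (t + \<tau>1)"
      "\<tau>1 \<noteq> 0" "c1 0 = a1"
    using axis_parametrisation[OF axes(1) a(1) a(1)] by metis
  obtain c2 \<tau>2 where 2: "isometry g2" "geodesic_on UNIV c2" "A2 = range c2" "\<And>t. g2 (c2 t) = c2 (t + \<tau>2)"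
      "\<tau>2 \<noteq> 0" "c2 0 = a2"
    using axis_parametrisation[OF axes(2) a(2) a(2)] by metis
  have b': "geodesic_on {0..dist a1 a2} b" "geodesic_on {0..dist a1 a2} (\<lambda>t. b (dist a1 a2 - t))"
      "b 0 = a1" "b (dist a1 a2) = a2"
    using b by (auto simp: geodesic_joining_def geodesic_on_def)
  have near1: "dist a2 (r s) = dist a1 a2 + s"
    if r: "geodesic_ray_from a1 r" "r ` {0..} \<subseteq> A1" and "0 \<le> s" for r s
    using angle_pi_imp_straight[OF X b'(1) _ _ angle1[OF r], of s] r that(3) b'
    by (auto simp: geodesic_ray_from_def geodesic_on_def)
  have near2: "dist a1 (r s) = dist a1 a2 + s"
    if r: "geodesic_ray_from a2 r" "r ` {0..} \<subseteq> A2" and "0 \<le> s" for r s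
    using angle_pi_imp_straight[OF X b'(2) _ _ angle2[OF r], of s] r that(3) b'
    by (auto simp: geodesic_ray_from_def geodesic_on_def)
  have arms: "geodesic_ray_from (c 0) (\<lambda>t. c (arm 0 p t))" if "geodesic_on UNIV c" for c :: "real \<Rightarrow> 'a" and p
    using line_rays[OF that, of 0] by (cases p) (auto simp: arm_def)
  show ?thesis
  proof (rule free_group_of_two_lines[OF X 1(1) 2(1) 1(2) 2(2) 1(4) 2(4) order_refl])
    show "0 < \<bar>\<tau>1\<bar>" "0 < \<bar>\<tau>2\<bar>"
      using 1(5) 2(5) by simp_all
  next
    fix p q and s t :: real assume st: "0 \<le> s" "0 \<le> t"
    have [simp]: "arm 0 p 0 = 0" for p by (simp add: arm_def)
    have on_lines: "(\<lambda>t. c1 (arm 0 p t)) ` {0..} \<subseteq> A1" "(\<lambda>t. c2 (arm 0 q t)) ` {0..} \<subseteq> A2"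
      unfolding 1(3) 2(3) by auto
    have "dist a1 (c1 (arm 0 p s)) = s"
      using 1 st geodesic_on_UNIV_dist[OF 1(2), of 0 "arm 0 p s"] by (auto simp: arm_def)
    then have "between_pts (c1 (arm 0 p s)) a1 a2"
      using near1[OF _ on_lines(1) st(1)] arms[OF 1(2), of p] 1(6)
      by (simp add: between_pts_def dist_commute)
    moreover have "dist a2 (c2 (arm 0 q t)) = t"
      using 2 st geodesic_on_UNIV_dist[OF 2(2), of 0 "arm 0 q t"] by (auto simp: arm_def)
    then have "between_pts a1 a2 (c2 (arm 0 q t))"
      using near2[OF _ on_lines(2) st(2)] arms[OF 2(2), of q] 2(6)
      by (simp add: between_pts_def dist_commute)
    moreover have "a1 \<noteq> a2" using a disj by auto
    ultimately show "aligned (c1 (arm 0 p s)) (c1 (arm 0 p 0)) (c2 (arm 0 q 0)) (c2 (arm 0 q t))"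
      using between_pts_overlap[OF X] 1 2 by simp
  qed
qed

theorem theorem1p1:
  fixes g1 g2 :: "'a::complete_space \<Rightarrow> 'a" and A1 A2 :: "'a set"
  assumes "CAT0 TYPE('a)"
    and "no_fake_zero_angles TYPE('a)"
    and "is_axis g1 A1"
    and "is_axis g2 A2"
    and "axes_meet_in_segment g1 A1 g2 A2 \<or> axes_joined_by_bridge A1 A2"
  shows "free_group (subgroup_generated isometry_group {g1, g2})"
  using free_group_of_axes_meeting_in_segment[OF assms(1,3,4)]
    free_group_of_axes_joined_by_bridge[OF assms(1,3,4)] assms(5) by blast

end
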